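(* Let $\mathbb{F}$ be any field, let $G=([n],E)$ be a directed graph and $\mathcal{S}_G=\langle\mathrm{E}_{i,j}\mid (i,j)\in E\rangle\le\mathrm{M}(n,\mathbb{F})$. The following are equivalent: (1) $G$ is acyclic; (2) $\mathcal{S}_G$ is nilpotent; (3) $\mathcal{S}_G$ is nil. Furthermore, $\mathrm{MaxWalkLen}(G)+1=\mathrm{NilInd}(\mathcal{S}_G)=\mathrm{NilptInd}(\mathcal{S}_G)$.
   Context: A directed graph $G=([n],E)$ has arc set $E\subseteq[n]\times[n]$ (self-loops allowed). A walk of length $k$ is a sequence $v_0,\dots,v_k$ with $(v_{i-1},v_i)\in E$ for all $i\in[k]$; a path is a walk without repeated vertices; a cycle is a walk $v_0,\dots,v_k$ with $k\ge1$, $v_0=v_k$ and no other repetitions (a self-loop is a cycle). $G$ is acyclic if it has no cycle. $\mathrm{MaxWalkLen}(G)$ is the maximum length of a walk in $G$, and is $\infty$ if $G$ has a cycle. $\mathrm{E}_{i,j}$ is the elementary $n\times n$ matrix with $1$ in position $(i,j)$. A matrix space $\mathcal{S}\le\mathrm{M}(n,\mathbb{F})$ is nil if every element is nilpotent; $\mathrm{NilInd}(\mathcal{S})$ is the smallest $k$ with $B^k=0$ for all $B\in\mathcal{S}$ ($\infty$ if not nil). $\mathcal{S}$ is nilpotent if there is $k$ with $B_1\cdots B_k=0$ for all $B_1,\dots,B_k\in\mathcal{S}$; the smallest such $k$ is $\mathrm{NilptInd}(\mathcal{S})$ ($\infty$ if none). *)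

theory Defs
  imports
    "Jordan_Normal_Form.VS_Connect"
    "Graph_Theory.Pair_Digraph"
    "HOL-Library.Extended_Nat"
begin

text \<open>The vertex set \<open>[n]\<close> is \<open>{0..<n}\<close>, which is also the range of the matrix indices of
  \<open>carrier_mat n n\<close>.\<close>

definition digraph_on :: "nat \<Rightarrow> (nat \<times> nat) set \<Rightarrow> nat pair_pre_digraph" where
  "digraph_on n E = \<lparr> pverts = {0..<n}, parcs = E \<rparr>"

text \<open>A walk \<open>v\<^sub>0, \<dots>, v\<^sub>k\<close> is represented by its start vertex together with its list of \<open>k\<close>
  arcs, see \<^const>\<open>pre_digraph.awalk\<close>; for \<open>k = 0\<close> the list is empty.  The library's
  \<^const>\<open>pre_digraph.cycle\<close> is a non-empty closed walk without repeated vertices apart from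
  \<open>v\<^sub>0 = v\<^sub>k\<close>, so self-loops are cycles.\<close>

definition acyclic_digraph :: "'a pair_pre_digraph \<Rightarrow> bool" where
  "acyclic_digraph G \<longleftrightarrow> \<not> (\<exists>p. pre_digraph.cycle (with_proj G) p)"

text \<open>Only meaningful if there is at least one vertex: otherwise there are no walks at all and
  the maximum is unspecified.\<close>

definition max_walk_len :: "'a pair_pre_digraph \<Rightarrow> enat" where
  "max_walk_len G =
    (if acyclic_digraph G
     then enat (Max {length p | u p v. pre_digraph.awalk (with_proj G) u p v})
     else \<infinity>)"

definition elem_mat :: "nat \<Rightarrow> nat \<Rightarrow> nat \<Rightarrow> 'a :: field mat" where
  "elem_mat n i j = mat n n (\<lambda>(a, b). if a = i \<and> b = j then 1 else 0)"

definition graph_space :: "nat \<Rightarrow> (nat \<times> nat) set \<Rightarrow> 'a :: field mat set" where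
  "graph_space n E =
    LinearCombinations.module.span class_ring (module_mat TYPE('a) n n)
      {elem_mat n i j | i j. (i, j) \<in> E}"

text \<open>In the following, \<open>S\<close> is a set of \<open>n \<times> n\<close> matrices.\<close>

definition nilpotent_mat :: "nat \<Rightarrow> 'a :: field mat \<Rightarrow> bool" where
  "nilpotent_mat n B \<longleftrightarrow> (\<exists>k. B ^\<^sub>m k = 0\<^sub>m n n)"

definition nil_space :: "nat \<Rightarrow> 'a :: field mat set \<Rightarrow> bool" where
  "nil_space n S \<longleftrightarrow> (\<forall>B\<in>S. nilpotent_mat n B)"

definition nil_ind :: "nat \<Rightarrow> 'a :: field mat set \<Rightarrow> enat" where
  "nil_ind n S =
    (if nil_space n S then enat (LEAST k. \<forall>B\<in>S. B ^\<^sub>m k = 0\<^sub>m n n) else \<infinity>)"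

definition mat_prod_list :: "nat \<Rightarrow> 'a :: field mat list \<Rightarrow> 'a mat" where
  "mat_prod_list n Bs = foldr (*) Bs (1\<^sub>m n)"

definition products_vanish :: "nat \<Rightarrow> 'a :: field mat set \<Rightarrow> nat \<Rightarrow> bool" where
  "products_vanish n S k \<longleftrightarrow>
    (\<forall>Bs. length Bs = k \<and> set Bs \<subseteq> S \<longrightarrow> mat_prod_list n Bs = 0\<^sub>m n n)"

definition nilpotent_space :: "nat \<Rightarrow> 'a :: field mat set \<Rightarrow> bool" where
  "nilpotent_space n S \<longleftrightarrow> (\<exists>k. products_vanish n S k)"

definition nilpt_ind :: "nat \<Rightarrow> 'a :: field mat set \<Rightarrow> enat" where
  "nilpt_ind n S =
    (if nilpotent_space n S then enat (LEAST k. products_vanish n S k) else \<infinity>)"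

end

theory Submission
  imports Defs
begin

text \<open>The space \<open>S\<^sub>G\<close> consists of all matrices supported on \<open>E\<close>, so a product of \<open>k\<close> of its elements
  can only be nonzero at \<open>(u, v)\<close> if there is a walk of length \<open>k\<close> from \<open>u\<close> to \<open>v\<close>.  Conversely,
  as \<open>E\<close> is finite, every vertex \<open>u\<close> has a successor \<open>f u\<close> that starts a walk of length \<open>k\<close>
  whenever \<open>u\<close> starts one of length \<open>k + 1\<close>: otherwise each of the finitely many successors would
  fail for some \<open>k\<close>, and a maximal such \<open>k\<close> would rule out a walk that exists.  The
  \<open>0\<close>-\<open>1\<close>-matrix \<open>B\<close> of the partial function \<open>f\<close> lies in \<open>S\<^sub>G\<close>, and \<open>B\<^sup>k \<noteq> 0\<close> as long as there is a
  walk of length \<open>k\<close>.  Hence the vanishing of all products of length \<open>k\<close>, the vanishing of all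
  \<open>k\<close>-th powers, \<open>B\<^sup>k = 0\<close> and the absence of walks of length \<open>k\<close> are all equivalent, which covers
  the cyclic and the acyclic case simultaneously.\<close>

section \<open>Walk lengths as powers of the arc relation\<close>

definition has_walk :: "nat \<Rightarrow> (nat \<times> nat) set \<Rightarrow> nat \<Rightarrow> bool" where
  "has_walk n E k \<longleftrightarrow> (\<exists>u<n. \<exists>v. (u, v) \<in> E ^^ k)"

lemma has_walk_antimono:
  assumes "has_walk n E k" "l \<le> k"
  shows "has_walk n E l"
proof -
  obtain u v where "u < n" "(u, v) \<in> E ^^ k"
    using assms(1) by (auto simp: has_walk_def)
  moreover have "E ^^ k = E ^^ l O E ^^ (k - l)"
    using assms(2) by (simp flip: relpow_add)
  ultimately show ?thesis
    by (auto simp: has_walk_def)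
qed

lemma persistent_successor:
  assumes fin: "finite (E `` {u})"
    and ne: "\<exists>v. (u, v) \<in> E"
  obtains w where "(u, w) \<in> E" "\<And>k v. (u, v) \<in> E ^^ Suc k \<Longrightarrow> \<exists>x. (w, x) \<in> E ^^ k"
proof (rule ccontr)
  assume "\<not> thesis"
  then have "\<forall>w\<in>E `` {u}. \<exists>k. (\<exists>v. (u, v) \<in> E ^^ Suc k) \<and> \<not> (\<exists>x. (w, x) \<in> E ^^ k)"
    using that by blast
  then obtain b where
    b: "\<And>w. w \<in> E `` {u} \<Longrightarrow> (\<exists>v. (u, v) \<in> E ^^ Suc (b w)) \<and> \<not> (\<exists>x. (w, x) \<in> E ^^ b w)"
    by metis
  define m where "m = Max (b ` (E `` {u}))"
  \<comment> \<open>The maximum is attained, so \<open>u\<close> starts a walk of length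
    \<open>m + 1\<close>. Its second vertex \<open>w\<close> starts one of length
    \<open>m \<ge> b w\<close>, whose first \<open>b w\<close> arcs contradict the choice of
    \<open>b w\<close>.\<close>
  have "m \<in> b ` (E `` {u})"
    unfolding m_def using fin ne by (intro Max_in) auto
  then obtain v where "(u, v) \<in> E ^^ Suc m"
    using b by blast
  then obtain w where w: "(u, w) \<in> E" "(w, v) \<in> E ^^ m"
    by (metis relpow_Suc_D2)
  have "b w \<le> m"
    unfolding m_def using fin w(1) by (intro Max_ge) auto
  then have "E ^^ m = E ^^ b w O E ^^ (m - b w)"
    by (simp flip: relpow_add)
  with w b[of w] show False
    by auto
qed

section \<open>The span as the matrices supported on the arcs\<close>

lemma graph_space_eq:
  assumes E: "E \<subseteq> {0..<n} \<times> {0..<n}"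
  shows "graph_space n E =
    {A \<in> carrier_mat n n. \<forall>i<n. \<forall>j<n. (i, j) \<notin> E \<longrightarrow> (A $$ (i, j) :: 'a :: field) = 0}"
    (is "_ = ?N")
proof
  let ?K = "class_ring :: 'a ring" and ?M = "module_mat TYPE('a) n n"
  let ?gens = "{elem_mat n i j :: 'a mat | i j. (i, j) \<in> E}"
  interpret vectorspace ?K ?M
    by (rule matrix_vs)
  have mod: "Module.module ?K ?M" ..
  have gens: "?gens \<subseteq> carrier ?M"
    by (auto simp: elem_mat_def module_mat_simps)
  have "submodule ?K ?N ?M"
    by (rule submodule.intro[OF mod]) (auto simp: matrix_vs_simps)
  then show "graph_space n E \<subseteq> ?N"
    unfolding graph_space_def by (rule span_is_subset[rotated]) (auto simp: elem_mat_def)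
  have sub: "submodule ?K (graph_space n E) ?M"
    unfolding graph_space_def by (rule span_is_submodule[OF gens])
  have elem: "elem_mat n i j \<in> (graph_space n E :: 'a mat set)" if "(i, j) \<in> E" for i j
    using in_own_span[OF gens] that unfolding graph_space_def by blast
  \<comment> \<open>Induction on a finite set \<open>F\<close> of arcs that contains the support of
    \<open>A\<close>: removing one arc leaves a matrix supported on the others plus a multiple of an
    elementary matrix. The case \<open>F = E\<close> gives the remaining inclusion.\<close>
  have "A \<in> graph_space n E"
    if "finite F" "F \<subseteq> E" "A \<in> carrier_mat n n"
      "\<And>i j. i < n \<Longrightarrow> j < n \<Longrightarrow> (i, j) \<notin> F \<Longrightarrow> A $$ (i, j) = 0" for F and A :: "'a mat"
    using that
  proof (induction F arbitrary: A rule: finite_induct)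
    case empty
    then have "A = 0\<^sub>m n n"
      by (intro eq_matI) auto
    then show ?case
      using submodule.zero_closed[OF sub] by (simp add: module_mat_simps)
  next
    case (insert e F)
    obtain a b where e: "e = (a, b)" and ab: "a < n" "b < n" "(a, b) \<in> E"
      using insert.prems(1) E by auto
    define A' where "A' = mat n n (\<lambda>(i, j). if (i, j) = e then 0 else A $$ (i, j))"
    have "A' \<in> graph_space n E"
      using insert.prems by (intro insert.IH) (auto simp: A'_def)
    moreover have "A $$ (a, b) \<cdot>\<^sub>m elem_mat n a b \<in> graph_space n E"
      using submodule.smult_closed[OF sub _ elem[OF ab(3)]] by (simp add: matrix_vs_simps)
    ultimately have "A' + A $$ (a, b) \<cdot>\<^sub>m elem_mat n a b \<in> graph_space n E"
      using submodule.m_closed[OF sub] by (simp add: matrix_vs_simps)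
    moreover have "A' + A $$ (a, b) \<cdot>\<^sub>m elem_mat n a b = A"
      using insert.prems(2) by (intro eq_matI) (auto simp: A'_def elem_mat_def e)
    ultimately show ?case
      by simp
  qed
  moreover have "finite E"
    using E finite_subset by blast
  ultimately show "?N \<subseteq> graph_space n E"
    by blast
qed

section \<open>Matrix products and walks\<close>

lemma mat_prod_list_carrier:
  "set Bs \<subseteq> carrier_mat n n \<Longrightarrow> mat_prod_list n Bs \<in> carrier_mat n n"
  by (induction Bs) (auto simp: mat_prod_list_def)

lemma mat_prod_list_Cons: "mat_prod_list n (B # Bs) = B * mat_prod_list n Bs"
  by (simp add: mat_prod_list_def)

lemma mat_prod_list_replicate:
  assumes B: "B \<in> carrier_mat n n"
  shows "mat_prod_list n (replicate k B) = B ^\<^sub>m k"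
proof (induction k)
  case 0
  show ?case
    using B by (simp add: mat_prod_list_def)
next
  case (Suc k)
  \<comment> \<open>The power takes its new factor on the right, the list product on the
    left.\<close>
  have "B * B ^\<^sub>m k = B ^\<^sub>m k * B"
    by (induction k) (use B in \<open>simp_all flip: assoc_mult_mat[of _ n n _ n _ n]\<close>)
  with Suc show ?case
    by (simp add: mat_prod_list_Cons)
qed

text \<open>A nonzero entry of a product has a nonzero summand, whose summation index serves as the
  vertex after the first arc.\<close>

lemma mat_prod_list_nonzero_entry:
  assumes E: "E \<subseteq> {0..<n} \<times> {0..<n}"
  shows "set Bs \<subseteq> graph_space n E \<Longrightarrow> u < n \<Longrightarrow> v < n \<Longrightarrow> mat_prod_list n Bs $$ (u, v) \<noteq> 0 \<Longrightarrow>
    (u, v) \<in> E ^^ length Bs"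
proof (induction Bs arbitrary: u)
  case Nil
  then show ?case
    by (simp add: mat_prod_list_def split: if_splits)
next
  case (Cons B Bs)
  have B: "B \<in> carrier_mat n n" "\<And>i j. i < n \<Longrightarrow> j < n \<Longrightarrow> (i, j) \<notin> E \<Longrightarrow> B $$ (i, j) = 0"
    using Cons.prems(1) by (auto simp: graph_space_eq[OF E])
  have Bs: "mat_prod_list n Bs \<in> carrier_mat n n"
    using Cons.prems(1) by (intro mat_prod_list_carrier) (auto simp: graph_space_eq[OF E])
  have "mat_prod_list n (B # Bs) $$ (u, v) = (\<Sum>w = 0..<n. B $$ (u, w) * mat_prod_list n Bs $$ (w, v))"
    using B(1) Bs Cons.prems by (simp add: mat_prod_list_Cons scalar_prod_def)
  with Cons.prems(4) obtain w where
    "w < n" "B $$ (u, w) \<noteq> 0" "mat_prod_list n Bs $$ (w, v) \<noteq> 0"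
    by (metis (no_types, lifting) sum.not_neutral_contains_not_neutral atLeastLessThan_iff
        mult_eq_0_iff)
  then have "(u, w) \<in> E" "(w, v) \<in> E ^^ length Bs"
    using B(2) Cons by auto
  then show ?case
    by (metis length_Cons relpow_Suc_I2)
qed

lemma products_vanish_if_no_walk:
  assumes E: "E \<subseteq> {0..<n} \<times> {0..<n}" and "\<not> has_walk n E k"
  shows "products_vanish n (graph_space n E) k"
  unfolding products_vanish_def
proof (intro allI impI)
  fix Bs :: "'a mat list"
  assume Bs: "length Bs = k \<and> set Bs \<subseteq> graph_space n E"
  then have "mat_prod_list n Bs \<in> carrier_mat n n"
    by (intro mat_prod_list_carrier) (auto simp: graph_space_eq[OF E])
  moreover have "mat_prod_list n Bs $$ (u, v) = 0" if "u < n" "v < n" for u v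
    using Bs assms(2) that mat_prod_list_nonzero_entry[OF E, of Bs u v]
    unfolding has_walk_def by blast
  ultimately show "mat_prod_list n Bs = 0\<^sub>m n n"
    by (intro eq_matI) auto
qed

lemma pow_zero_if_products_vanish:
  fixes B :: "'a :: field mat"
  assumes E: "E \<subseteq> {0..<n} \<times> {0..<n}"
    and "products_vanish n (graph_space n E :: 'a mat set) k" "B \<in> graph_space n E"
  shows "B ^\<^sub>m k = 0\<^sub>m n n"
proof -
  have "B \<in> carrier_mat n n"
    using assms(3) by (auto simp: graph_space_eq[OF E])
  moreover have "mat_prod_list n (replicate k B) = 0\<^sub>m n n"
    using assms(2,3) by (simp add: products_vanish_def set_replicate_conv_if)
  ultimately show ?thesis
    by (simp add: mat_prod_list_replicate)
qed

lemma graph_space_witness: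
  assumes E: "E \<subseteq> {0..<n} \<times> {0..<n}"
  obtains B :: "'a :: field mat"
  where "B \<in> graph_space n E" "\<And>k. has_walk n E k \<Longrightarrow> B ^\<^sub>m k \<noteq> 0\<^sub>m n n"
proof -
  have "finite E"
    using E finite_subset by blast
  then have fin: "finite (E `` {u})" for u
    by (rule finite_Image)
  \<comment> \<open>A vertex without successors starts no walk of positive length, so any
    \<open>w\<close> will do there and \<open>f\<close> can be total.\<close>
  have "\<exists>w. \<forall>k v. (u, v) \<in> E ^^ Suc k \<longrightarrow> (u, w) \<in> E \<and> (\<exists>x. (w, x) \<in> E ^^ k)" for u
  proof (cases "\<exists>v. (u, v) \<in> E")
    case True
    show ?thesis
      by (rule persistent_successor[OF fin True]) blast
  next
    case False
    then show ?thesis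
      by (blast dest: relpow_Suc_D2)
  qed
  then obtain f where
    f: "\<And>u k v. (u, v) \<in> E ^^ Suc k \<Longrightarrow> (u, f u) \<in> E \<and> (\<exists>x. (f u, x) \<in> E ^^ k)"
    by metis
  \<comment> \<open>Testing \<open>(i, j) \<in> E\<close> discards the arbitrary values of
    \<open>f\<close> at vertices without successors and keeps \<open>B\<close> in the span.\<close>
  define B :: "'a mat" where "B = mat n n (\<lambda>(i, j). if (i, j) \<in> E \<and> j = f i then 1 else 0)"
  have carr: "B \<in> carrier_mat n n"
    by (simp add: B_def)
  \<comment> \<open>Powers of \<open>B\<close> follow the iterates of \<open>f\<close>. The walk to
    \<open>v\<close> only guarantees that \<open>k\<close> steps along \<open>f\<close> are
    possible; these may end at a vertex other than \<open>v\<close>.\<close>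
  have "mat_prod_list n (replicate k B) $$ (u, (f ^^ k) u) = 1 \<and> (f ^^ k) u < n"
    if "u < n" "(u, v) \<in> E ^^ k" for u v k
    using that
  proof (induction k arbitrary: u v)
    case 0
    then show ?case
      by (simp add: mat_prod_list_def)
  next
    case (Suc k)
    obtain x where fu: "(u, f u) \<in> E" "f u < n" and x: "(f u, x) \<in> E ^^ k"
      using f[OF Suc.prems(2)] E by auto
    let ?C = "mat_prod_list n (replicate k B)" and ?w = "(f ^^ k) (f u)"
    have IH: "?C $$ (f u, ?w) = 1" "?w < n"
      using Suc.IH[OF fu(2) x] by auto
    have C: "?C \<in> carrier_mat n n"
      using carr by (intro mat_prod_list_carrier) auto
    have "mat_prod_list n (replicate (Suc k) B) $$ (u, ?w) = (\<Sum>j = 0..<n. B $$ (u, j) * ?C $$ (j, ?w))"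
      using carr C Suc.prems(1) IH(2) by (simp add: mat_prod_list_Cons scalar_prod_def)
    \<comment> \<open>Row \<open>u\<close> of \<open>B\<close> has its single nonzero entry in
      column \<open>f u\<close>.\<close>
    also have "\<dots> = (\<Sum>j = 0..<n. if j = f u then ?C $$ (j, ?w) else 0)"
      using Suc.prems(1) fu by (intro sum.cong) (auto simp: B_def)
    also have "\<dots> = 1"
      using fu IH by simp
    finally show ?case
      using IH(2) by (simp add: funpow_swap1)
  qed
  then have "B ^\<^sub>m k \<noteq> 0\<^sub>m n n" if "has_walk n E k" for k
    using that carr unfolding has_walk_def mat_prod_list_replicate[OF carr]
    by (metis index_zero_mat(1) zero_neq_one)
  moreover have "B \<in> graph_space n E"
    by (auto simp: graph_space_eq[OF E] B_def)
  ultimately show thesis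
    using that by blast
qed

section \<open>Walks and cycles of the digraph\<close>

lemma digraph_on_simps:
  "pverts (digraph_on n E) = {0..<n}" "parcs (digraph_on n E) = E"
  by (simp_all add: digraph_on_def)

lemma pair_wf_digraph_on:
  assumes "E \<subseteq> {0..<n} \<times> {0..<n}"
  shows "pair_wf_digraph (digraph_on n E)"
  using assms by unfold_locales (auto simp: digraph_on_simps)

text \<open>Induction on the length, splitting off the first arc. As \<open>E ^^ 0\<close> relates
  every natural number to itself, \<open>u < n\<close> confines empty walks to the vertices.\<close>

lemma awalk_iff_relpow:
  assumes E: "E \<subseteq> {0..<n} \<times> {0..<n}"
  shows "(\<exists>p. pre_digraph.awalk (with_proj (digraph_on n E)) u p v \<and> length p = k) \<longleftrightarrow>
    u < n \<and> (u, v) \<in> E ^^ k"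
proof -
  interpret pair_wf_digraph "digraph_on n E"
    by (rule pair_wf_digraph_on[OF E])
  show ?thesis
  proof (induction k arbitrary: u)
    case 0
    then show ?case
      by (auto simp: awalk_Nil_iff digraph_on_simps)
  next
    case (Suc k)
    have "(\<exists>p. awalk u p v \<and> length p = Suc k) \<longleftrightarrow>
        (\<exists>w. (u, w) \<in> E \<and> (\<exists>p. awalk w p v \<and> length p = k))"
    proof (intro iffI; elim exE conjE)
      fix p assume "awalk u p v" "length p = Suc k"
      then show "\<exists>w. (u, w) \<in> E \<and> (\<exists>p. awalk w p v \<and> length p = k)"
        by (cases p) (auto simp: awalk_Cons_iff digraph_on_simps intro!: exI conjI)
    next
      fix w p assume "(u, w) \<in> E" "awalk w p v" "length p = k"
      then have "awalk u ((u, w) # p) v \<and> length ((u, w) # p) = Suc k"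
        by (simp add: awalk_Cons_iff digraph_on_simps)
      then show "\<exists>p. awalk u p v \<and> length p = Suc k" ..
    qed
    also have "\<dots> \<longleftrightarrow> (\<exists>w. (u, w) \<in> E \<and> (w, v) \<in> E ^^ k)"
      using E unfolding Suc by fastforce
    also have "\<dots> \<longleftrightarrow> u < n \<and> (u, v) \<in> E ^^ Suc k"
      using E
      by (fastforce simp del: relpow.simps intro: relpow_Suc_I2 dest: relpow_Suc_D2)
    finally show ?case .
  qed
qed

lemma has_walk_iff_awalk:
  assumes "E \<subseteq> {0..<n} \<times> {0..<n}"
  shows "has_walk n E k \<longleftrightarrow>
    (\<exists>u p v. pre_digraph.awalk (with_proj (digraph_on n E)) u p v \<and> length p = k)"
proof -
  have "has_walk n E k \<longleftrightarrow>
      (\<exists>u v. \<exists>p. pre_digraph.awalk (with_proj (digraph_on n E)) u p v \<and> length p = k)"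
    unfolding has_walk_def awalk_iff_relpow[OF assms] by blast
  then show ?thesis
    by blast
qed

text \<open>Without cycles no walk repeats a vertex, which bounds its length; going round a cycle
  yields arbitrarily long walks.\<close>

lemma acyclic_digraph_iff_no_walk:
  assumes E: "E \<subseteq> {0..<n} \<times> {0..<n}"
  shows "acyclic_digraph (digraph_on n E) \<longleftrightarrow> (\<exists>k. \<not> has_walk n E k)"
proof -
  interpret pair_wf_digraph "digraph_on n E"
    by (rule pair_wf_digraph_on[OF E])
  note has_walk_iff = has_walk_iff_awalk[OF E]
  show ?thesis
  proof
    assume acyc: "acyclic_digraph (digraph_on n E)"
    have "length p < Suc n" if p: "awalk u p v" for u p v
    proof -
      have "distinct (awalk_verts u p)"
      proof (rule ccontr)
        assume "\<not> distinct (awalk_verts u p)"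
        \<comment> \<open>A repeated vertex cuts out a nonempty closed walk, and every such walk
          contains a cycle.\<close>
        with p obtain r w where "awalk w r w" "0 < length r"
          using awalk_not_distinct_decomp by force
        then have "closed_w r"
          by (auto simp: closed_w_def)
        with acyc show False
          using closed_w_imp_cycle by (auto simp: acyclic_digraph_def)
      qed
      then have "length (awalk_verts u p) = card (set (awalk_verts u p))"
        by (simp add: distinct_card)
      also have "\<dots> \<le> card {0..<n}"
        using p unfolding awalk_conv digraph_on_simps by (intro card_mono) simp_all
      finally show ?thesis
        using length_awalk_verts[of u p] by simp
    qed
    then have "\<not> has_walk n E (Suc n)"
      using has_walk_iff by (metis less_irrefl)
    then show "\<exists>k. \<not> has_walk n E k" ..
  next
    assume no: "\<exists>k. \<not> has_walk n E k"
    show "acyclic_digraph (digraph_on n E)"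
      unfolding acyclic_digraph_def
    proof
      assume "\<exists>p. cycle p"
      then obtain u p where p: "awalk u p u" "p \<noteq> []"
        unfolding cycle_def by blast
      have "awalk u (concat (replicate k p)) u" for k
      proof (induction k)
        case 0
        show ?case
          using awalk_hd_in_verts[OF p(1)] by (simp add: awalk_Nil_iff)
      next
        case (Suc k)
        show ?case
          using awalk_appendI[OF p(1) Suc] by simp
      qed
      moreover have "k \<le> length (concat (replicate k p))" for k
        using p(2) by (simp add: length_concat sum_list_replicate Suc_le_eq)
      \<comment> \<open>Multiples of the length of \<open>p\<close> may miss \<open>k\<close>
        itself; truncating a longer walk closes the gap.\<close>
      ultimately have "\<exists>l\<ge>k. has_walk n E l" for k
        unfolding has_walk_iff by blast
      with no show False
        using has_walk_antimono by blast
    qed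
  qed
qed

section \<open>From walk lengths to the indices\<close>

lemma Max_plus_1_eq_Least:
  fixes P :: "nat \<Rightarrow> bool"
  assumes mono: "\<And>k l. P k \<Longrightarrow> l \<le> k \<Longrightarrow> P l" and "P 0" and "\<not> P m"
  shows "Max {k. P k} + 1 = (LEAST k. \<not> P k)"
proof -
  define L where "L = (LEAST k. \<not> P k)"
  have L: "\<not> P L"
    unfolding L_def using assms(3) by (rule LeastI)
  \<comment> \<open>\<open>P\<close> is downward closed, so it holds exactly below its first
    failure. By \<open>P 0\<close> this initial segment is nonempty and has a maximum.\<close>
  have "P k \<longleftrightarrow> k < L" for k
    using L mono[of k L] not_less_Least[of k "\<lambda>k. \<not> P k"] unfolding L_def[symmetric]
    by (meson not_le)
  then have "{k. P k} = {..<L}"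
    by auto
  moreover obtain l where "L = Suc l"
    using L \<open>P 0\<close> by (cases L) auto
  moreover have "Max {..l} = l"
    by (intro Max_eqI) auto
  ultimately show ?thesis
    by (simp add: lessThan_Suc_atMost flip: L_def)
qed

theorem theorem4p2:
  fixes n :: nat
    and E :: "(nat \<times> nat) set"
    and S\<^sub>G :: "'a :: field mat set"
  assumes "E \<subseteq> {0..<n} \<times> {0..<n}"
    and "S\<^sub>G = graph_space n E"
  shows "(acyclic_digraph (digraph_on n E) \<longleftrightarrow> nilpotent_space n S\<^sub>G) \<and>
    (nilpotent_space n S\<^sub>G \<longleftrightarrow> nil_space n S\<^sub>G) \<and>
    (n \<ge> 1 \<longrightarrow>
      max_walk_len (digraph_on n E) + 1 = nil_ind n S\<^sub>G \<and>
      nil_ind n S\<^sub>G = nilpt_ind n S\<^sub>G)"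
proof -
  note E = assms(1)
  obtain B :: "'a mat" where
    B: "B \<in> S\<^sub>G" "\<And>k. has_walk n E k \<Longrightarrow> B ^\<^sub>m k \<noteq> 0\<^sub>m n n"
    using graph_space_witness[OF E] unfolding assms(2) by blast
  have pv: "products_vanish n S\<^sub>G k \<longleftrightarrow> \<not> has_walk n E k" for k
    using B products_vanish_if_no_walk[OF E] pow_zero_if_products_vanish[OF E]
    unfolding assms(2) by blast
  have pow: "(\<forall>A\<in>S\<^sub>G. A ^\<^sub>m k = 0\<^sub>m n n) \<longleftrightarrow> \<not> has_walk n E k" for k
    using B products_vanish_if_no_walk[OF E] pow_zero_if_products_vanish[OF E]
    unfolding assms(2) by blast
  have acyc: "acyclic_digraph (digraph_on n E) \<longleftrightarrow> (\<exists>k. \<not> has_walk n E k)"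
    by (rule acyclic_digraph_iff_no_walk[OF E])
  have nilpotent: "nilpotent_space n S\<^sub>G \<longleftrightarrow> (\<exists>k. \<not> has_walk n E k)"
    by (simp add: nilpotent_space_def pv)
  \<comment> \<open>In a nil space the exponent may depend on the matrix, but an exponent for
    \<open>B\<close> alone already excludes a walk length.\<close>
  have nil: "nil_space n S\<^sub>G \<longleftrightarrow> (\<exists>k. \<not> has_walk n E k)"
    using B pow unfolding nil_space_def nilpotent_mat_def by blast
  \<comment> \<open>All three quantities reduce to the least length without a walk, or to
    \<open>\<infinity>\<close> if every length has one.\<close>
  have "max_walk_len (digraph_on n E) + 1 =
      (if \<exists>k. \<not> has_walk n E k then enat (LEAST k. \<not> has_walk n E k) else \<infinity>)" if "n \<ge> 1"
  proof (cases "\<exists>k. \<not> has_walk n E k")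
    case True
    \<comment> \<open>As \<open>n \<ge> 1\<close>, there is an empty walk, so the maximum is taken
      over a nonempty set.\<close>
    have "has_walk n E 0"
      using that by (auto simp: has_walk_def Suc_le_eq)
    moreover have "{length p | u p v. pre_digraph.awalk (with_proj (digraph_on n E)) u p v} =
        {k. has_walk n E k}"
      using has_walk_iff_awalk[OF E] by auto
    ultimately have "Max {length p | u p v. pre_digraph.awalk (with_proj (digraph_on n E)) u p v} + 1 =
        (LEAST k. \<not> has_walk n E k)"
      using True Max_plus_1_eq_Least[of "has_walk n E"] has_walk_antimono by metis
    then show ?thesis
      using True by (simp add: max_walk_len_def acyc one_enat_def)
  next
    case False
    then show ?thesis
      by (simp add: max_walk_len_def acyc)
  qed
  moreover have "Least (products_vanish n S\<^sub>G) = (LEAST k. \<not> has_walk n E k)"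
    by (rule arg_cong[where f = Least]) (simp add: fun_eq_iff pv)
  ultimately show ?thesis
    by (simp add: acyc nilpotent nil nil_ind_def nilpt_ind_def pow)
qed

end
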